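(* Let $q$ be a prime power, $n\ge 1$, and let $W$ be an $n$-dimensional affine space over the finite field $\mathbb{F}_q$. Let $A_1,\dots,A_m$ and $B_1,\dots,B_m$ be affine subspaces of $W$ such that $A_i\cap B_i=\emptyset$ for each $1\le i\le m$ and $A_i\cap B_j\neq\emptyset$ whenever $1\le i<j\le m$. Then $$m\le 2\cdot\frac{q^n-1}{q-1}.$$
   Context: An affine subspace of $W$ (identified with $\mathbb{F}_q^n$) is a set of the form $v+V=\{v+x: x\in V\}$ with $v\in W$ and $V$ a linear subspace of $\mathbb{F}_q^n$. No restriction $q\neq 2$ is imposed. *)

theory Defs
  imports "HOL-Analysis.Cartesian_Space"
begin

(* The library predicate affine is restricted to real vector spaces. A translate v + V contains v,
   so affine subspaces are nonempty. *)
definition affine_subspace :: "('a::field ^ 'n) set \<Rightarrow> bool" where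
  "affine_subspace S \<longleftrightarrow> (\<exists>v V. vec.subspace V \<and> S = {v + x |x. x \<in> V})"

end

theory Submission
  imports Defs
begin

text \<open>If the translates \<open>a + U\<close> and \<open>b + V\<close> are disjoint, then \<open>a - b \<notin> U + V\<close>, so some linear
  functional vanishes on \<open>U + V\<close> but not at \<open>a - b\<close>: it separates the two subspaces, being constant
  on each with different values. The nonzero multiples of a separating functional separate too.
  Conversely, a functional separates at most two of the pairs: if it separated the pairs
  \<open>i < j < k\<close> with values \<open>\<alpha>\<close> on the \<open>A\<close> side and \<open>\<beta>\<close> on the \<open>B\<close> side, the intersections
  would give \<open>\<alpha>\<^sub>j = \<beta>\<^sub>k = \<alpha>\<^sub>i = \<beta>\<^sub>j\<close>. Counting the incidences between pairs and separating functionals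
  in both ways gives \<open>m (q - 1) \<le> 2 (q\<^sup>n - 1)\<close>.\<close>

text \<open>Every linear functional on the coordinate space has this form for exactly one
  \<open>d\<close>, so counting functionals amounts to counting vectors.\<close>

definition dotp :: "'a::field ^ 'n::finite \<Rightarrow> 'a ^ 'n \<Rightarrow> 'a" where
  "dotp d x = (\<Sum>j\<in>UNIV. d $ j * x $ j)"

definition separates :: "'a::field ^ 'n::finite \<Rightarrow> ('a ^ 'n) set \<Rightarrow> ('a ^ 'n) set \<Rightarrow> bool" where
  "separates d S T \<longleftrightarrow>
    (\<exists>\<alpha> \<beta>. \<alpha> \<noteq> \<beta> \<and> (\<forall>x\<in>S. dotp d x = \<alpha>) \<and> (\<forall>x\<in>T. dotp d x = \<beta>))"

lemma dotp_add: "dotp d (x + y) = dotp d x + dotp d y"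
  by (simp add: dotp_def algebra_simps sum.distrib)

lemma dotp_diff: "dotp d (x - y) = dotp d x - dotp d y"
  by (simp add: dotp_def algebra_simps sum_subtractf)

lemma dotp_zero_left [simp]: "dotp 0 x = 0"
  by (simp add: dotp_def)

lemma dotp_scale_left: "dotp (c *s d) x = c * dotp d x"
  by (simp add: dotp_def sum_distrib_left mult.assoc)

text \<open>A basis of \<open>S\<close> stays independent when \<open>w\<close> is added, so some
  linear map kills \<open>S\<close> and fixes \<open>w\<close>. Since \<open>w\<close> is nonzero,
  one of the coordinates of this map is the required functional.\<close>

lemma exists_functional_not_in_subspace:
  fixes w :: "'a::field ^ 'n::finite"
  assumes "vec.subspace S" "w \<notin> S"
  obtains d where "\<And>x. x \<in> S \<Longrightarrow> dotp d x = 0" "dotp d w \<noteq> 0"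
proof -
  obtain X where X: "X \<subseteq> S" "vec.independent X" "S \<subseteq> vec.span X"
    using vec.maximal_independent_subset by blast
  have span: "vec.span X = S"
    using X(1,3) assms(1) vec.span_minimal by blast
  have wX: "w \<notin> vec.span X"
    using assms(2) span by simp
  then have "vec.independent (insert w X)"
    using X(2) vec.independent_insertI by blast
  then obtain g where g: "Vector_Spaces.linear (*s) (*s) g"
    and gX: "\<And>x. x \<in> insert w X \<Longrightarrow> g x = (if x = w then w else 0)"
    using vec.linear_independent_extend[of "insert w X" "\<lambda>x. if x = w then w else 0"] by blast
  have "w \<noteq> 0"
    using wX vec.span_zero by blast
  then obtain k where k: "w $ k \<noteq> 0"
    by (auto simp: vec_eq_iff)
  \<comment> \<open>Row \<open>k\<close> of the matrix of \<open>g\<close> represents the functional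
    that takes \<open>x\<close> to coordinate \<open>k\<close> of \<open>g x\<close>.\<close>
  have gk: "dotp (matrix g $ k) x = g x $ k" for x
    using matrix_works[OF g, of x] by (simp add: dotp_def matrix_vector_mult_def vec_eq_iff)
  show thesis
  proof
    fix x assume "x \<in> S"
    then have "x \<in> vec.span X" by (simp add: span)
    moreover have "g y = 0" if "y \<in> X" for y
      using gX[of y] that wX vec.span_base by fastforce
    ultimately have "g x = 0"
      using vec.linear_eq_0_on_span[OF g] by blast
    then show "dotp (matrix g $ k) x = 0"
      by (simp add: gk)
  next
    show "dotp (matrix g $ k) w \<noteq> 0"
      using k gX[of w] by (simp add: gk)
  qed
qed

lemma disjoint_affine_subspaces_separated:
  fixes S T :: "('a::field ^ 'n::finite) set"
  assumes "affine_subspace S" "affine_subspace T" "S \<inter> T = {}"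
  obtains d where "separates d S T"
proof -
  obtain a U where U: "vec.subspace U" and S: "S = {a + x |x. x \<in> U}"
    using assms(1) unfolding affine_subspace_def by blast
  obtain b V where V: "vec.subspace V" and T: "T = {b + x |x. x \<in> V}"
    using assms(2) unfolding affine_subspace_def by blast
  let ?UV = "{x + y |x y. x \<in> U \<and> y \<in> V}"
  have "a - b \<notin> ?UV"
  proof
    assume "a - b \<in> ?UV"
    then obtain u v where uv: "u \<in> U" "v \<in> V" "a - b = u + v" by blast
    then have "a + - u = b + v" by (simp add: algebra_simps)
    moreover have "- u \<in> U" using U uv(1) by (rule vec.subspace_neg)
    ultimately have "b + v \<in> S \<inter> T" using S T uv(2) by force
    then show False using assms(3) by blast
  qed
  then obtain d where d: "\<And>x. x \<in> ?UV \<Longrightarrow> dotp d x = 0" "dotp d (a - b) \<noteq> 0"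
    using exists_functional_not_in_subspace[OF vec.subspace_sums[OF U V]] by blast
  have "dotp d x = 0" if "x \<in> U" for x
    using d(1)[of x] that vec.subspace_0[OF V] by force
  moreover have "dotp d x = 0" if "x \<in> V" for x
    using d(1)[of x] that vec.subspace_0[OF U] by force
  ultimately have "separates d S T"
    using d(2) unfolding separates_def S T
    by (intro exI[of _ "dotp d a"] exI[of _ "dotp d b"]) (auto simp: dotp_add dotp_diff)
  then show thesis ..
qed

lemma affine_subspace_nonempty: "affine_subspace S \<Longrightarrow> S \<noteq> {}"
  unfolding affine_subspace_def using vec.subspace_0 by fastforce

text \<open>On an empty set every value is attained vacuously, so the zero functional could
  separate; two nonempty sets rule this out.\<close>

lemma separates_nonzero:
  assumes "separates d S T" "S \<noteq> {}" "T \<noteq> {}"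
  shows "d \<noteq> 0"
  using assms unfolding separates_def by fastforce

lemma separates_scale:
  assumes "separates d S T" "c \<noteq> 0"
  shows "separates (c *s d) S T"
  using assms unfolding separates_def by (metis dotp_scale_left mult_left_cancel)

lemma card_separating_ge:
  fixes d :: "'a::{field,finite} ^ 'n::finite"
  assumes "separates d S T" "S \<noteq> {}" "T \<noteq> {}"
  shows "CARD('a) - 1 \<le> card {e. separates e S T}"
proof -
  have "d \<noteq> 0" using separates_nonzero[OF assms] .
  then have "inj_on (\<lambda>c. c *s d) (- {0})"
    by (auto simp: inj_on_def)
  then have "card ((\<lambda>c. c *s d) ` (- {0})) = CARD('a) - 1"
    by (simp add: card_image Compl_eq_Diff_UNIV card_Diff_singleton)
  moreover have "(\<lambda>c. c *s d) ` (- {0}) \<subseteq> {e. separates e S T}"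
    using separates_scale[OF assms(1)] by auto
  ultimately show ?thesis
    by (metis card_mono finite_class.finite)
qed

lemma not_separates_three:
  assumes "separates d (A j) (B j)" "separates d (A i) (B i)" "separates d (A k) (B k)"
    and "A i \<inter> B j \<noteq> {}" "A i \<inter> B k \<noteq> {}" "A j \<inter> B k \<noteq> {}"
  shows False
  using assms unfolding separates_def by (metis disjoint_iff)

lemma card_separated_le:
  fixes A B :: "nat \<Rightarrow> ('a::field ^ 'n::finite) set"
  assumes "\<And>i j. 1 \<le> i \<Longrightarrow> i < j \<Longrightarrow> j \<le> m \<Longrightarrow> A i \<inter> B j \<noteq> {}"
  shows "card {i \<in> {1..m}. separates d (A i) (B i)} \<le> 2" (is "card ?I \<le> 2")
proof (cases "?I = {}")
  case False
  have fin: "finite ?I" by simp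
  have mem: "Min ?I \<in> ?I" "Max ?I \<in> ?I"
    using Min_in[OF fin False] Max_in[OF fin False] by blast+
  \<comment> \<open>A third index would lie strictly between the extremes and complete a forbidden
    increasing triple.\<close>
  have "?I \<subseteq> {Min ?I, Max ?I}"
  proof (rule ccontr)
    assume "\<not> ?thesis"
    then obtain j where j: "j \<in> ?I" "j \<noteq> Min ?I" "j \<noteq> Max ?I" by blast
    then have lt: "Min ?I < j" "j < Max ?I"
      using Min_le[OF fin j(1)] Max_ge[OF fin j(1)] by linarith+
    show False
      by (rule not_separates_three[of d A j B "Min ?I" "Max ?I"])
        (use j mem lt assms in \<open>simp_all\<close>)
  qed
  then have "card ?I \<le> card {Min ?I, Max ?I}"
    by (intro card_mono) auto
  also have "\<dots> \<le> 2"
    \<comment> \<open>Only an inequality, since the minimum and the maximum may coincide.\<close>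
    by (simp add: card_insert_if)
  finally show ?thesis .
next
  case True
  then show ?thesis by (simp only: card.empty)
qed

theorem theorem2p1:
  fixes A B :: "nat \<Rightarrow> ('a::{field,finite} ^ 'n::finite) set"
    and q n m :: nat
  assumes "q = CARD('a)" and "n = CARD('n)"
    and "\<And>i. i \<in> {1..m} \<Longrightarrow> affine_subspace (A i)"
    and "\<And>i. i \<in> {1..m} \<Longrightarrow> affine_subspace (B i)"
    and "\<And>i. i \<in> {1..m} \<Longrightarrow> A i \<inter> B i = {}"
    and "\<And>i j. 1 \<le> i \<Longrightarrow> i < j \<Longrightarrow> j \<le> m \<Longrightarrow> A i \<inter> B j \<noteq> {}"
  shows "real m \<le> 2 * ((real q ^ n - 1) / (real q - 1))"
proof -
  let ?sep = "\<lambda>i d. separates d (A i) (B i)"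
  have ne: "A i \<noteq> {}" "B i \<noteq> {}" if "i \<in> {1..m}" for i
    using that assms(3,4) affine_subspace_nonempty by blast+
  have ge: "q - 1 \<le> card {d \<in> - {0}. ?sep i d}" if i: "i \<in> {1..m}" for i
  proof -
    obtain d where "?sep i d"
      using disjoint_affine_subspaces_separated assms(3-5) i by metis
    \<comment> \<open>Discarding \<open>0\<close> loses no separating functional, and it is what
      makes the final count \<open>q ^ n - 1\<close> instead of \<open>q ^ n\<close>.\<close>
    moreover have "{d \<in> - {0}. ?sep i d} = {d. ?sep i d}"
      using separates_nonzero ne[OF i] by blast
    ultimately show ?thesis
      using card_separating_ge ne[OF i] assms(1) by simp
  qed
  have "m * (q - 1) = (\<Sum>i\<in>{1..m}. q - 1)"
    by simp
  also have "\<dots> \<le> (\<Sum>i\<in>{1..m}. card {d \<in> - {0}. ?sep i d})"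
    using ge by (rule sum_mono)
  \<comment> \<open>The double count: incidences are now grouped by functional instead of by
    pair.\<close>
  also have "\<dots> = (\<Sum>d\<in>- {0}. card {i \<in> {1..m}. ?sep i d})"
    by (rule sum_multicount_gen) auto
  also have "\<dots> \<le> (\<Sum>d\<in>- {0 :: 'a ^ 'n}. 2)"
    by (intro sum_mono card_separated_le assms(6))
  also have "\<dots> = 2 * (q ^ n - 1)"
    by (simp add: Compl_eq_Diff_UNIV card_Diff_singleton assms(1,2))
  finally have "real (m * (q - 1)) \<le> real (2 * (q ^ n - 1))"
    by (simp only: of_nat_le_iff)
  \<comment> \<open>A field contains \<open>0 \<noteq> 1\<close>. Hence the natural-number
    subtractions are not truncated, and division by \<open>q - 1\<close> is legitimate.\<close>
  moreover have "1 < q"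
    using card_mono[of UNIV "{0, 1 :: 'a}"] assms(1) by simp
  ultimately show ?thesis
    by (simp add: of_nat_diff field_simps)
qed

end
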